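(* Let $S\subseteq T\subseteq\mathbb{N}^*$ be trees, where $T$ is finitely branching and each node of $T$ has at least two successors on $T$. Suppose that $S$ is uniformly branching. Then, in the metric space $[T]$, $$\dim_H[S]=\underline{\dim}_B[S]\quad\text{and}\quad \dim_P[S]=\overline{\dim}_B[S].$$
   Context: $\mathbb{N}^*$ is the set of finite tuples of natural numbers. A tree is a nonempty set of tuples closed under initial segments; the subtree $S$ has no leaves (so that $S$ corresponds to the nonempty closed set $[S]$). $T_n$ is the set of strings in $T$ of length $n$, and $[T]$ is the set of infinite paths through $T$, with the ultrametric $d(f,g)=\max\{|T_n|^{-1}: f(n)\neq g(n)\}$, where $\max\emptyset=0$. $[S]\subseteq[T]$ is the set of infinite paths through $S$. A tree $S$ is uniformly branching if for each $n$, all strings in $S$ of length $n$ have the same number of successors on $S$. For a bounded set $X$ in a metric space, $N_\alpha(X)$ is the least cardinality of a covering of $X$ by sets of diameter at most $\alpha$, and $$\underline{\dim}_B(X)=\liminf_{\alpha\to0^+}\frac{\log N_\alpha(X)}{\log(1/\alpha)},\qquad \overline{\dim}_B(X)=\limsup_{\alpha\to0^+}\frac{\log N_\alpha(X)}{\log(1/\alpha)}.$$ $\dim_H$ is Hausdorff dimension. $\dim_P$ is packing dimension: for $s\ge0$, let $P^s_0(X)=\lim_{\delta\to0^+}\sup\sum_i (2r_i)^s$, the supremum being over countable families of pairwise disjoint balls with centres in $X$ and radii $r_i\le\delta$; let $P^s(X)=\inf\{\sum_j P^s_0(X_j): X\subseteq\bigcup_{j\in\mathbb{N}} X_j\}$;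 then $\dim_P(X)=\inf\{s: P^s(X)=0\}$. Dimensions may take the value $\infty$. *)

theory Defs
  imports "HOL-Analysis.Analysis" "HOL-Library.Sublist"
begin

section \<open>Dimensions in a metric space\<close>

context Metric_space
begin

definition ediam :: "'a set \<Rightarrow> ennreal" where
  "ediam A = (SUP x\<in>A. SUP y\<in>A. ennreal (d x y))"

subsection \<open>Box dimension\<close>

text \<open>The value is \<open>\<infinity>\<close> if there is no finite covering by sets of diameter at most \<open>\<alpha>\<close>.\<close>

definition covering_number :: "'a set \<Rightarrow> real \<Rightarrow> enat" where
  "covering_number X \<alpha> =
     (INF C \<in> {C. finite C \<and> X \<subseteq> \<Union>C \<and> (\<forall>A\<in>C. A \<subseteq> M \<and> ediam A \<le> ennreal \<alpha>)}. enat (card C))"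

definition log_covering_number :: "'a set \<Rightarrow> real \<Rightarrow> ereal" where
  "log_covering_number X \<alpha> =
     (case covering_number X \<alpha> of enat n \<Rightarrow> if n = 0 then -\<infinity> else ereal (ln (real n)) | \<infinity> \<Rightarrow> \<infinity>)"

definition lower_box_dim :: "'a set \<Rightarrow> ereal" where
  "lower_box_dim X = Liminf (at_right 0) (\<lambda>\<alpha>. log_covering_number X \<alpha> / ereal (ln (1 / \<alpha>)))"

definition upper_box_dim :: "'a set \<Rightarrow> ereal" where
  "upper_box_dim X = Limsup (at_right 0) (\<lambda>\<alpha>. log_covering_number X \<alpha> / ereal (ln (1 / \<alpha>)))"

subsection \<open>Hausdorff dimension\<close>

text \<open>\<open>diam(A)\<^sup>s\<close> with the usual conventions \<open>diam(A)\<^sup>0 = 1\<close> for \<open>A \<noteq> {}\<close> and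
  \<open>diam({})\<^sup>s = 0\<close>; note that \<open>0 powr 0 = 0\<close> in HOL. It is only applied to sets of finite
  diameter.\<close>

definition diam_powr :: "'a set \<Rightarrow> real \<Rightarrow> ennreal" where
  "diam_powr A s =
     (if A = {} then 0 else if s = 0 then 1 else ennreal (enn2real (ediam A) powr s))"

definition hausdorff_premeasure :: "real \<Rightarrow> real \<Rightarrow> 'a set \<Rightarrow> ennreal" where
  "hausdorff_premeasure s \<delta> X =
     (INF U \<in> {U :: nat \<Rightarrow> 'a set. X \<subseteq> (\<Union>i. U i) \<and> (\<forall>i. U i \<subseteq> M \<and> ediam (U i) \<le> ennreal \<delta>)}.
        \<Sum>i. diam_powr (U i) s)"

definition hausdorff_measure :: "real \<Rightarrow> 'a set \<Rightarrow> ennreal" where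
  "hausdorff_measure s X = (SUP \<delta>\<in>{0<..}. hausdorff_premeasure s \<delta> X)"

text \<open>As infima in \<^typ>\<open>ereal\<close>, this and the packing dimension are \<open>\<infinity>\<close> if there is no such \<open>s\<close>.\<close>

definition hausdorff_dim :: "'a set \<Rightarrow> ereal" where
  "hausdorff_dim X = Inf {ereal s | s. 0 \<le> s \<and> hausdorff_measure s X = 0}"

subsection \<open>Packing dimension\<close>

text \<open>Packings are indexed by sets \<open>I\<close> of naturals, hence may be finite or countably infinite.
  A ball is given by its centre and radius, which the underlying set need not determine.\<close>

definition packing :: "real \<Rightarrow> 'a set \<Rightarrow> nat set \<Rightarrow> (nat \<Rightarrow> 'a) \<Rightarrow> (nat \<Rightarrow> real) \<Rightarrow> bool" where
  "packing \<delta> X I c r \<longleftrightarrow>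
     (\<forall>i\<in>I. c i \<in> X \<and> 0 < r i \<and> r i \<le> \<delta>) \<and> disjoint_family_on (\<lambda>i. mcball (c i) (r i)) I"

definition packing_sup :: "real \<Rightarrow> real \<Rightarrow> 'a set \<Rightarrow> ennreal" where
  "packing_sup s \<delta> X =
     Sup {(\<Sum>\<^sub>\<infinity>i\<in>I. ennreal ((2 * r i) powr s)) | I c r. packing \<delta> X I c r}"

definition packing_premeasure :: "real \<Rightarrow> 'a set \<Rightarrow> ennreal" where
  "packing_premeasure s X = Lim (at_right 0) (\<lambda>\<delta>. packing_sup s \<delta> X)"

definition packing_measure :: "real \<Rightarrow> 'a set \<Rightarrow> ennreal" where
  "packing_measure s X =
     (INF Y \<in> {Y :: nat \<Rightarrow> 'a set. (\<forall>j. Y j \<subseteq> M) \<and> X \<subseteq> (\<Union>j. Y j)}. \<Sum>j. packing_premeasure s (Y j))"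

definition packing_dim :: "'a set \<Rightarrow> ereal" where
  "packing_dim X = Inf {ereal s | s. 0 \<le> s \<and> packing_measure s X = 0}"

lemma packing_sup_mono:
  assumes "\<delta> \<le> \<delta>'"
  shows "packing_sup s \<delta> X \<le> packing_sup s \<delta>' X"
  unfolding packing_sup_def
proof (rule Sup_subset_mono, safe)
  fix I c r assume "packing \<delta> X I c r"
  then have "packing \<delta>' X I c r" using assms unfolding packing_def by force
  then show "\<exists>I' c' r'. (\<Sum>\<^sub>\<infinity>i\<in>I. ennreal ((2 * r i) powr s)) = (\<Sum>\<^sub>\<infinity>i\<in>I'. ennreal ((2 * r' i) powr s))
      \<and> packing \<delta>' X I' c' r'"
    by blast
qed

lemma packing_sup_tendsto_INF:
  "((\<lambda>\<delta>. packing_sup s \<delta> X) \<longlongrightarrow> (INF \<delta>\<in>{0<..}. packing_sup s \<delta> X)) (at_right 0)"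
proof (rule order_tendstoI)
  fix a assume "a < (INF \<delta>\<in>{0<..}. packing_sup s \<delta> X)"
  then have "a < packing_sup s \<delta> X" if "\<delta> > 0" for \<delta>
    using that by (meson INF_lower greaterThan_iff less_le_trans)
  then show "eventually (\<lambda>\<delta>. a < packing_sup s \<delta> X) (at_right 0)"
    by (auto simp: eventually_at_right_field intro: exI[of _ 1])
next
  fix a assume "(INF \<delta>\<in>{0<..}. packing_sup s \<delta> X) < a"
  then obtain e where "e > 0" "packing_sup s e X < a"
    by (auto simp: INF_less_iff)
  then show "eventually (\<lambda>\<delta>. packing_sup s \<delta> X < a) (at_right 0)"
    unfolding eventually_at_right_field
    by (meson le_less_trans less_imp_le packing_sup_mono)
qed

lemma packing_premeasure_eq_INF:
  "packing_premeasure s X = (INF \<delta>\<in>{0<..}. packing_sup s \<delta> X)"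
  unfolding packing_premeasure_def
  by (rule tendsto_Lim[OF _ packing_sup_tendsto_INF]) simp

end

section \<open>Trees\<close>

definition tree :: "nat list set \<Rightarrow> bool" where
  "tree T \<longleftrightarrow> T \<noteq> {} \<and> (\<forall>\<tau>\<in>T. \<forall>\<sigma>. prefix \<sigma> \<tau> \<longrightarrow> \<sigma> \<in> T)"

definition succs :: "nat list set \<Rightarrow> nat list \<Rightarrow> nat list set" where
  "succs T \<sigma> = {\<tau> \<in> T. \<exists>k. \<tau> = \<sigma> @ [k]}"

definition no_leaves :: "nat list set \<Rightarrow> bool" where
  "no_leaves T \<longleftrightarrow> (\<forall>\<sigma>\<in>T. succs T \<sigma> \<noteq> {})"

definition finitely_branching :: "nat list set \<Rightarrow> bool" where
  "finitely_branching T \<longleftrightarrow> (\<forall>\<sigma>\<in>T. finite (succs T \<sigma>))"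

definition level :: "nat list set \<Rightarrow> nat \<Rightarrow> nat list set" where
  "level T n = {\<sigma> \<in> T. length \<sigma> = n}"

text \<open>Equipollence rather than \<^const>\<open>card\<close>, so that infinite successor sets are also
  compared correctly.\<close>

definition uniformly_branching :: "nat list set \<Rightarrow> bool" where
  "uniformly_branching T \<longleftrightarrow> (\<forall>n. \<forall>\<sigma>\<in>level T n. \<forall>\<tau>\<in>level T n. succs T \<sigma> \<approx> succs T \<tau>)"

definition paths :: "nat list set \<Rightarrow> (nat \<Rightarrow> nat) set" where
  "paths T = {f. \<forall>n. map f [0..<n] \<in> T}"

text \<open>The sequence \<open>|T\<^sub>n|\<inverse>\<close> is nonincreasing when \<open>T\<close> is finitely branching without leaves, so
  the supremum is a maximum, attained at the least \<open>n\<close> with \<open>f n \<noteq> g n\<close>; inserting \<open>0\<close>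
  implements \<open>max {} = 0\<close>.\<close>

definition path_dist :: "nat list set \<Rightarrow> (nat \<Rightarrow> nat) \<Rightarrow> (nat \<Rightarrow> nat) \<Rightarrow> real" where
  "path_dist T f g = Sup (insert 0 {1 / real (card (level T n)) | n. f n \<noteq> g n})"

lemma finite_level:
  assumes "tree T" "finitely_branching T"
  shows "finite (level T n)"
proof (induction n)
  case 0
  have "level T 0 \<subseteq> {[]}" by (auto simp: level_def)
  then show ?case by (rule finite_subset) simp
next
  case (Suc n)
  have "level T (Suc n) \<subseteq> (\<Union>\<sigma>\<in>level T n. succs T \<sigma>)"
  proof
    fix \<tau> assume \<tau>: "\<tau> \<in> level T (Suc n)"
    then obtain \<sigma> k where "\<tau> = \<sigma> @ [k]"
      by (cases \<tau> rule: rev_cases) (auto simp: level_def)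
    with \<tau> assms(1) show "\<tau> \<in> (\<Union>\<sigma>\<in>level T n. succs T \<sigma>)"
      unfolding level_def succs_def tree_def by fastforce
  qed
  moreover have "finite (\<Union>\<sigma>\<in>level T n. succs T \<sigma>)"
    using Suc assms(2) by (auto simp: finitely_branching_def level_def)
  ultimately show ?case by (rule finite_subset)
qed

lemma bdd_above_path_dist: "bdd_above (insert 0 {1 / real (card (level T n)) | n. f n \<noteq> g n})"
proof (rule bdd_aboveI[of _ 1])
  fix x assume "x \<in> insert 0 {1 / real (card (level T n)) | n. f n \<noteq> g n}"
  then consider "x = 0" | n where "x = 1 / real (card (level T n))" by blast
  then show "x \<le> 1"
  proof cases
    case (2 n)
    then show ?thesis by (cases "card (level T n)") auto
  qed simp
qed

lemma path_dist_upper: "f n \<noteq> g n \<Longrightarrow> 1 / real (card (level T n)) \<le> path_dist T f g"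
  unfolding path_dist_def by (rule cSup_upper[OF _ bdd_above_path_dist]) auto

lemma path_dist_nonneg: "0 \<le> path_dist T f g"
  unfolding path_dist_def by (rule cSup_upper[OF _ bdd_above_path_dist]) auto

lemma path_dist_ultra: "path_dist T f h \<le> max (path_dist T f g) (path_dist T g h)"
proof -
  have "Sup (insert 0 {1 / real (card (level T n)) | n. f n \<noteq> h n})
      \<le> max (path_dist T f g) (path_dist T g h)"
  proof (rule cSup_least)
    fix x assume "x \<in> insert 0 {1 / real (card (level T n)) | n. f n \<noteq> h n}"
    then consider "x = 0" | n where "x = 1 / real (card (level T n))" "f n \<noteq> h n" by blast
    then show "x \<le> max (path_dist T f g) (path_dist T g h)"
    proof cases
      case 1
      then show ?thesis using path_dist_nonneg[of T f g] by linarith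
    next
      case (2 n)
      then consider "f n \<noteq> g n" | "g n \<noteq> h n" by fastforce
      then show ?thesis
        using 2(1) path_dist_upper[of f n g T] path_dist_upper[of g n h T] by cases auto
    qed
  qed simp
  then show ?thesis by (simp add: path_dist_def)
qed

lemma Metric_space_paths:
  assumes "tree T" "finitely_branching T"
  shows "Metric_space (paths T) (path_dist T)"
proof
  fix f g h :: "nat \<Rightarrow> nat"
  show "0 \<le> path_dist T f g" by (rule path_dist_nonneg)
  show "path_dist T f g = path_dist T g f"
    unfolding path_dist_def by (simp add: eq_commute)
  show "path_dist T f h \<le> path_dist T f g + path_dist T g h"
    using path_dist_ultra[of T f h g] path_dist_nonneg[of T f g] path_dist_nonneg[of T g h]
    by linarith
  assume "f \<in> paths T"
  have pos: "card (level T n) > 0" for n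
  proof -
    have "map f [0..<n] \<in> level T n"
      using \<open>f \<in> paths T\<close> by (simp add: paths_def level_def)
    then show ?thesis using finite_level[OF assms] by (auto simp: card_gt_0_iff)
  qed
  show "path_dist T f g = 0 \<longleftrightarrow> f = g"
  proof
    assume *: "path_dist T f g = 0"
    show "f = g"
    proof (rule ccontr)
      assume "f \<noteq> g"
      then obtain n where "f n \<noteq> g n" by blast
      then have "1 / real (card (level T n)) \<le> 0" using path_dist_upper * by metis
      with pos[of n] show False by simp
    qed
  qed (simp add: path_dist_def)
qed

end

theory Submission
  imports Defs
begin

text \<open>The inequalities \<open>\<le>\<close> hold in every metric space. For the converses write \<open>t n\<close> and \<open>s n\<close> for
  the sizes of level \<open>n\<close> of \<open>T\<close> and \<open>S\<close>. Cylinders of level \<open>n\<close> have diameter at most \<open>1 / t n\<close>, so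
  \<open>s n\<close> of them bound the covering number at scale \<open>1 / t n\<close>. As \<open>S\<close> is uniformly branching, the
  uniform mass gives each of these cylinders mass \<open>1 / s n\<close>, and below the lower box dimension the
  mass distribution principle applies. For packings, any countable cover of the paths of \<open>S\<close> has a
  member dense in some cylinder (Baire category), and by uniform branching that member contains
  centres for a fixed proportion of \<open>s n\<close> disjoint balls at every later level \<open>n\<close>.\<close>

section \<open>Inequalities in arbitrary metric spaces\<close>

lemma frequently_less_of_Liminf_less:
  fixes f :: "'a \<Rightarrow> 'b :: complete_linorder"
  assumes "Liminf F f < c"
  shows "\<exists>\<^sub>F x in F. f x < c"
  proof (rule ccontr)
  assume "\<not> ?thesis"
  then have "\<forall>\<^sub>F x in F. c \<le> f x" by (simp add: not_frequently not_less)
  then have "c \<le> Liminf F f" by (rule Liminf_bounded)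
  with assms show False by simp
qed

lemma frequently_greater_of_less_Limsup:
  fixes f :: "'a \<Rightarrow> 'b :: complete_linorder"
  assumes "c < Limsup F f"
  shows "\<exists>\<^sub>F x in F. c < f x"
  proof (rule ccontr)
  assume "\<not> ?thesis"
  then have "\<forall>\<^sub>F x in F. f x \<le> c" by (simp add: not_frequently not_less)
  then have "Limsup F f \<le> c" by (rule Limsup_bounded)
  with assms show False by simp
qed

text \<open>Shifting the indices by \<open>m\<close> embeds \<open>K\<close> into the naturals, so
  the sum is part of a full geometric series.\<close>

lemma sum_power_le_geometric_tail:
  fixes q :: real
  assumes "0 \<le> q" "q < 1" "finite K" "K \<subseteq> {m..}"
  shows "(\<Sum>k\<in>K. q ^ k) \<le> q ^ m / (1 - q)"
proof -
  have sums: "(\<lambda>k. q ^ (k + m)) sums (q ^ m * (1 / (1 - q)))"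
    using sums_mult[OF geometric_sums[of q], of "q ^ m"] assms by (simp add: power_add mult.commute)
  have sm: "summable (\<lambda>k. q ^ (k + m))" and eq: "(\<Sum>k. q ^ (k + m)) = q ^ m / (1 - q)"
    using sums by (auto simp: sums_iff)
  have "inj_on (\<lambda>k. k - m) K"
    using assms(4) by (intro inj_onI) (metis atLeast_iff eq_diff_iff subsetD)
  then have "(\<Sum>k\<in>K. q ^ k) = (\<Sum>k\<in>(\<lambda>k. k - m) ` K. q ^ (k + m))"
    using assms(4) by (subst sum.reindex) (auto simp: subset_iff intro!: sum.cong)
  also have "\<dots> \<le> (\<Sum>k. q ^ (k + m))"
    using assms by (intro sum_le_suminf sm) auto
  finally show ?thesis using eq by simp
qed

text \<open>It suffices that \<open>x < e powr (1 / a)\<close>. Below, \<open>a\<close> is the gap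
  between two exponents, and the small power absorbs constants.\<close>

lemma eventually_powr_less_at_right_0:
  fixes a e :: real
  assumes "0 < a" "0 < e"
  shows "\<forall>\<^sub>F x in at_right 0. x powr a < e"
proof -
  have "\<forall>\<^sub>F x in at_right (0::real). x < e powr (1 / a)"
    using assms by (intro eventually_at_rightI[of _ "e powr (1 / a)"]) auto
  then show ?thesis
    using eventually_at_right_less[of 0]
  proof eventually_elim
    case (elim x)
    then have "x powr a < (e powr (1 / a)) powr a"
      using assms by (intro powr_less_mono2) auto
    then show ?case using assms by (simp add: powr_powr)
  qed
qed

context Metric_space
begin

section \<open>Box dimension in terms of finite covers\<close>

lemma ediam_le_iff:
  assumes "0 \<le> \<alpha>"
  shows "ediam A \<le> ennreal \<alpha> \<longleftrightarrow> (\<forall>x\<in>A. \<forall>y\<in>A. d x y \<le> \<alpha>)"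
  using assms unfolding ediam_def by (auto simp: SUP_le_iff)

definition fine_cover :: "'a set \<Rightarrow> real \<Rightarrow> 'a set set \<Rightarrow> bool" where
  "fine_cover X \<alpha> C \<longleftrightarrow> finite C \<and> X \<subseteq> \<Union>C \<and> (\<forall>A\<in>C. A \<subseteq> M \<and> ediam A \<le> ennreal \<alpha>)"

lemma covering_number_fine_cover:
  "covering_number X \<alpha> = (INF C \<in> {C. fine_cover X \<alpha> C}. enat (card C))"
  unfolding covering_number_def fine_cover_def ..

text \<open>A finite infimum of cardinalities is attained, and \<open>\<alpha> < 1\<close> makes the
  denominator positive, so the inequality can be exponentiated. All later arguments about box
  dimension thus count members of finite covers and avoid logarithms in
  \<open>ereal\<close>.\<close>

lemma log_covering_ratio_less_iff:
  assumes "X \<noteq> {}" "0 < \<alpha>" "\<alpha> < 1"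
  shows "log_covering_number X \<alpha> / ereal (ln (1 / \<alpha>)) < ereal s \<longleftrightarrow>
    (\<exists>C. fine_cover X \<alpha> C \<and> real (card C) < (1 / \<alpha>) powr s)"
proof (cases "covering_number X \<alpha>")
  case (enat n)
  have "covering_number X \<alpha> < enat (Suc n)" using enat by simp
  then obtain C where C: "fine_cover X \<alpha> C" "card C < Suc n"
    unfolding covering_number_fine_cover INF_less_iff by auto
  have least: "n \<le> card D" if "fine_cover X \<alpha> D" for D
  proof -
    have "covering_number X \<alpha> \<le> enat (card D)"
      unfolding covering_number_fine_cover using that by (intro INF_lower) auto
    then show ?thesis using enat by simp
  qed
  have card: "card C = n" using C least by force
  \<comment> \<open>This excludes the value \<open>-\<infinity>\<close> of
    \<open>log_covering_number\<close>, taken only when the empty family covers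
    \<open>X\<close>.\<close>
  have "n \<noteq> 0"
    using C(1) card assms(1) by (auto simp: fine_cover_def)
  have pos: "ln (1 / \<alpha>) > 0" using assms by simp
  have "log_covering_number X \<alpha> / ereal (ln (1 / \<alpha>)) = ereal (ln n / ln (1 / \<alpha>))"
    using enat \<open>n \<noteq> 0\<close> pos by (simp add: log_covering_number_def)
  then have "log_covering_number X \<alpha> / ereal (ln (1 / \<alpha>)) < ereal s \<longleftrightarrow> ln n < s * ln (1 / \<alpha>)"
    using pos by (simp add: pos_divide_less_eq)
  also have "\<dots> \<longleftrightarrow> ln n < ln ((1 / \<alpha>) powr s)"
    using assms by (subst ln_powr) auto
  also have "\<dots> \<longleftrightarrow> real n < (1 / \<alpha>) powr s"
    using \<open>n \<noteq> 0\<close> assms by (intro ln_less_cancel_iff) auto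
  also have "\<dots> \<longleftrightarrow> (\<exists>C. fine_cover X \<alpha> C \<and> real (card C) < (1 / \<alpha>) powr s)"
    using C(1) card least by (meson le_less_trans of_nat_le_iff)
  finally show ?thesis .
next
  case infinity
  have pos: "ln (1 / \<alpha>) > 0" using assms by simp
  have "\<not> fine_cover X \<alpha> C" for C
    using infinity INF_lower[of C "{C. fine_cover X \<alpha> C}" "\<lambda>C. enat (card C)"]
    unfolding covering_number_fine_cover by auto
  moreover have "log_covering_number X \<alpha> / ereal (ln (1 / \<alpha>)) = \<infinity>"
    using infinity pos assms by (simp add: log_covering_number_def divide_ereal_def)
  ultimately show ?thesis by simp
qed

text \<open>Every cover of a nonempty set has a member, so the ratio is nonnegative once
  \<open>\<alpha> < 1\<close>. Hence exponents above a box dimension are positive.\<close>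

lemma lower_box_dim_nonneg:
  assumes "X \<noteq> {}"
  shows "0 \<le> lower_box_dim X"
  unfolding lower_box_dim_def
proof (rule Liminf_bounded)
  show "\<forall>\<^sub>F \<alpha> in at_right 0. 0 \<le> log_covering_number X \<alpha> / ereal (ln (1 / \<alpha>))"
    unfolding eventually_at_right_field
  proof (intro exI[of _ 1] conjI allI impI)
    fix \<alpha> :: real assume \<alpha>: "0 < \<alpha>" "\<alpha> < 1"
    have "\<not> real (card C) < (1 / \<alpha>) powr 0" if "fine_cover X \<alpha> C" for C
      using that assms \<alpha> by (auto simp: fine_cover_def not_less card_gt_0_iff Suc_le_eq)
    then have "\<not> log_covering_number X \<alpha> / ereal (ln (1 / \<alpha>)) < ereal 0"
      unfolding log_covering_ratio_less_iff[OF assms \<alpha>] by blast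
    then show "0 \<le> log_covering_number X \<alpha> / ereal (ln (1 / \<alpha>))"
      by (simp add: not_less zero_ereal_def)
  qed simp
qed

lemma lower_box_dim_le_upper_box_dim: "lower_box_dim X \<le> upper_box_dim X"
  unfolding lower_box_dim_def upper_box_dim_def by (rule Liminf_le_Limsup) simp

section \<open>Hausdorff dimension is at most lower box dimension\<close>

lemma diam_powr_le:
  assumes "0 < s" "0 \<le> \<alpha>" "ediam A \<le> ennreal \<alpha>"
  shows "diam_powr A s \<le> ennreal (\<alpha> powr s)"
proof -
  have "enn2real (ediam A) \<le> \<alpha>"
    using assms by (metis enn2real_ennreal enn2real_mono ennreal_less_top)
  then show ?thesis
    using assms by (auto simp: diam_powr_def intro!: ennreal_leI powr_mono2)
qed

lemma hausdorff_premeasure_le_fine_cover: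
  assumes "0 < s" "0 \<le> \<alpha>" "\<alpha> \<le> \<delta>" "fine_cover X \<alpha> C"
  shows "hausdorff_premeasure s \<delta> X \<le> ennreal (real (card C) * \<alpha> powr s)"
proof -
  have fin: "finite C" using assms by (simp add: fine_cover_def)
  obtain h where h: "bij_betw h {..<card C} C"
    using ex_bij_betw_nat_finite[OF fin] by (auto simp: atLeast0LessThan)
  \<comment> \<open>The finite cover is padded to a sequence by empty sets, whose
    \<open>diam_powr\<close> is 0.\<close>
  define U where "U i = (if i < card C then h i else {})" for i
  have hC: "h i \<in> C" if "i < card C" for i using h that by (auto simp: bij_betw_def)
  have \<alpha>: "ediam (h i) \<le> ennreal \<alpha>" if "i < card C" for i
    using hC[OF that] assms(4) by (simp add: fine_cover_def)
  have "C = h ` {..<card C}" using h by (simp add: bij_betw_def)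
  then have "\<Union>C \<subseteq> (\<Union>i. U i)" unfolding U_def by force
  then have 1: "X \<subseteq> (\<Union>i. U i)" using assms(4) by (auto simp: fine_cover_def)
  have 2: "U i \<subseteq> M \<and> ediam (U i) \<le> ennreal \<delta>" for i
    using hC[of i] assms(4) order_trans[OF \<alpha>[of i] ennreal_leI[OF assms(3)]]
    by (auto simp: U_def fine_cover_def ediam_def)
  have "hausdorff_premeasure s \<delta> X \<le> (\<Sum>i. diam_powr (U i) s)"
    unfolding hausdorff_premeasure_def using 1 2 by (intro INF_lower) auto
  also have "\<dots> = (\<Sum>i<card C. diam_powr (U i) s)"
    by (rule suminf_finite) (auto simp: U_def diam_powr_def)
  also have "\<dots> \<le> (\<Sum>i<card C. ennreal (\<alpha> powr s))"
    using \<alpha> by (intro sum_mono) (auto simp: U_def intro!: diam_powr_le assms)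
  also have "\<dots> = ennreal (real (card C) * \<alpha> powr s)"
    by (simp add: ennreal_mult ennreal_of_nat_eq_real_of_nat)
  finally show ?thesis .
qed

text \<open>For exponents \<open>s' < s\<close> above the lower box dimension, there are arbitrarily
  small \<open>\<alpha>\<close> with covers by fewer than \<open>(1 / \<alpha>) powr s'\<close>
  sets. Their \<open>s\<close>-weight is at most \<open>\<alpha> powr (s - s')\<close>, which tends
  to 0.\<close>

lemma hausdorff_dim_le_lower_box_dim:
  assumes "X \<noteq> {}"
  shows "hausdorff_dim X \<le> lower_box_dim X"
proof (rule dense_ge)
  fix x assume x: "lower_box_dim X < x"
  show "hausdorff_dim X \<le> x"
  proof (cases x)
    case (real s)
    obtain s' where s': "lower_box_dim X < ereal s'" "s' < s"
      using ereal_dense2[OF x] real by auto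
    have "0 < s'" using s'(1) lower_box_dim_nonneg[OF assms] by (metis ereal_less(2) le_less_trans)
    have "hausdorff_premeasure s \<delta> X \<le> 0" if "\<delta> > 0" for \<delta>
    proof (rule ennreal_le_epsilon)
      fix e :: real assume "e > 0"
      \<comment> \<open>The lower limit provides good scales only frequently; one of them below
        \<open>\<delta>\<close> is enough for the premeasure.\<close>
      have "\<exists>\<^sub>F \<alpha> in at_right 0. log_covering_number X \<alpha> / ereal (ln (1 / \<alpha>)) < ereal s'"
        using s'(1) unfolding lower_box_dim_def by (rule frequently_less_of_Liminf_less)
      moreover have "\<forall>\<^sub>F \<alpha> in at_right 0. 0 < \<alpha> \<and> \<alpha> < 1 \<and> \<alpha> < \<delta> \<and> \<alpha> powr (s - s') < e"
        using s'(2) \<open>e > 0\<close> \<open>\<delta> > 0\<close>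
        by (intro eventually_conj eventually_powr_less_at_right_0 eventually_at_right_less)
          (auto intro: eventually_at_rightI[of _ 1] eventually_at_rightI[of _ \<delta>])
      ultimately have "\<exists>\<alpha>. (0 < \<alpha> \<and> \<alpha> < 1 \<and> \<alpha> < \<delta> \<and> \<alpha> powr (s - s') < e) \<and>
          log_covering_number X \<alpha> / ereal (ln (1 / \<alpha>)) < ereal s'"
        by (rule frequently_ex[OF frequently_eventually_conj])
      then obtain \<alpha> where \<alpha>: "0 < \<alpha>" "\<alpha> < 1" "\<alpha> < \<delta>" "\<alpha> powr (s - s') < e"
        "log_covering_number X \<alpha> / ereal (ln (1 / \<alpha>)) < ereal s'"
        by blast
      obtain C where C: "fine_cover X \<alpha> C" "real (card C) < (1 / \<alpha>) powr s'"
        using log_covering_ratio_less_iff[OF assms \<alpha>(1,2)] \<alpha>(5) by blast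
      have "real (card C) * \<alpha> powr s \<le> (1 / \<alpha>) powr s' * \<alpha> powr s"
        using C(2) by (intro mult_right_mono) auto
      also have "\<dots> = \<alpha> powr (s - s')"
        using \<alpha>(1) by (simp add: powr_diff powr_divide)
      finally have "real (card C) * \<alpha> powr s \<le> e" using \<alpha>(4) by simp
      then show "hausdorff_premeasure s \<delta> X \<le> 0 + ennreal e"
        using hausdorff_premeasure_le_fine_cover[OF _ _ _ C(1), of s \<delta>] \<open>0 < s'\<close> s'(2) \<alpha>
        by (simp add: ennreal_leI order_trans)
    qed
    then have "hausdorff_measure s X = 0"
      unfolding hausdorff_measure_def by (intro antisym SUP_least) auto
    then show ?thesis
      unfolding hausdorff_dim_def using \<open>0 < s'\<close> s'(2) real by (intro Inf_lower) auto
  qed (use x in auto)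
qed

section \<open>Packing dimension is at most upper box dimension\<close>

text \<open>A set of diameter at most the common lower bound \<open>\<alpha>\<close> of the radii contains at most
  one centre of a packing.\<close>

lemma card_packing_le_fine_cover:
  assumes "packing \<delta> X I c r" "F \<subseteq> I" "\<forall>i\<in>F. \<alpha> \<le> r i" "0 \<le> \<alpha>" "fine_cover X \<alpha> C"
  shows "card F \<le> card C"
proof -
  have "c i \<in> X" if "i \<in> F" for i
    using that assms(1,2) by (auto simp: packing_def)
  moreover have "X \<subseteq> \<Union>C"
    using assms(5) by (simp add: fine_cover_def)
  ultimately have "\<exists>A\<in>C. c i \<in> A" if "i \<in> F" for i
    using that by blast
  then obtain A where A: "\<And>i. i \<in> F \<Longrightarrow> A i \<in> C" "\<And>i. i \<in> F \<Longrightarrow> c i \<in> A i"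
    by metis
  have "inj_on A F"
  proof (rule inj_onI, rule ccontr)
    fix i j assume ij: "i \<in> F" "j \<in> F" "A i = A j" "i \<noteq> j"
    have "A i \<subseteq> M" "ediam (A i) \<le> ennreal \<alpha>" using A(1)[OF ij(1)] assms(5) by (auto simp: fine_cover_def)
    then have "c i \<in> M" "c j \<in> M" "d (c i) (c j) \<le> \<alpha>"
      using A(2)[OF ij(1)] A(2)[OF ij(2)] ij(3) ediam_le_iff[OF assms(4)] by auto
    \<comment> \<open>The distance of the two centres is at most \<open>\<alpha>\<close>, hence at
      most \<open>r i\<close>.\<close>
    then have "c j \<in> mcball (c i) (r i) \<inter> mcball (c j) (r j)"
      using assms(3,4) ij(1,2) by force
    moreover have "disjoint_family_on (\<lambda>i. mcball (c i) (r i)) I"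
      using assms(1) by (simp add: packing_def)
    ultimately show False
      using ij assms(2) unfolding disjoint_family_on_def by blast
  qed
  then show ?thesis
    using A(1) assms(5) by (intro card_inj_on_le[of A]) (auto simp: fine_cover_def)
qed

text \<open>The balls of a packing are grouped by the dyadic scale of their radii, so that the sum
  is dominated by a geometric series.\<close>

lemma packing_sum_le:
  assumes s: "0 \<le> s'" "s' < s"
    and cov: "\<And>k. m \<le> k \<Longrightarrow> \<exists>C. fine_cover X ((1/2) ^ Suc k) C \<and> real (card C) \<le> (2 ^ Suc k) powr s'"
    and pack: "packing ((1/2) ^ m) X I c r" and F: "finite F" "F \<subseteq> I"
  shows "(\<Sum>i\<in>F. (2 * r i) powr s) \<le> 2 powr (s + s') * ((2 powr (s' - s)) ^ m / (1 - 2 powr (s' - s)))"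
proof -
  define q :: real where "q = 2 powr (s' - s)"
  have q: "0 \<le> q" "q < 1" using s by (auto simp: q_def powr_less_one)
  have r: "0 < r i" "r i \<le> (1/2) ^ m" if "i \<in> F" for i
    using pack F(2) that by (auto simp: packing_def)
  \<comment> \<open>The dyadic scale of ball \<open>i\<close>:
    \<open>(1/2) ^ Suc (k i) < r i \<le> (1/2) ^ k i\<close>. When \<open>k i = 0\<close>, leastness
    says nothing, and the upper bound comes from \<open>r i \<le> (1/2) ^ m \<le> 1\<close>.\<close>
  define k where "k i = (LEAST k. (1/2) ^ Suc k < r i)" for i
  have k1: "(1/2) ^ Suc (k i) < r i" if "i \<in> F" for i
  proof -
    have "\<exists>n. (1/2) ^ n < r i" using real_arch_pow_inv[of "r i" "1/2"] r(1)[OF that] by auto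
    then obtain n where "(1/2) ^ n < r i" ..
    moreover have "(1/2::real) ^ Suc n \<le> (1/2) ^ n" by simp
    ultimately have "(1/2) ^ Suc n < r i" by linarith
    then show ?thesis unfolding k_def by (rule LeastI)
  qed
  have k2: "r i \<le> (1/2) ^ k i" if "i \<in> F" for i
  proof (cases "k i")
    case 0
    have "(1/2::real) ^ m \<le> 1" by (simp add: power_le_one)
    then show ?thesis using r(2)[OF that] 0 by simp
  next
    case (Suc n)
    then have "\<not> (1/2) ^ Suc n < r i" using not_less_Least[of n "\<lambda>k. (1/2) ^ Suc k < r i"] by (simp add: k_def)
    then show ?thesis using Suc by simp
  qed
  have k3: "m \<le> k i" if "i \<in> F" for i
  proof -
    have "(1/2::real) ^ Suc (k i) < (1/2) ^ m" using k1[OF that] r(2)[OF that] by linarith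
    then have "m < Suc (k i)" by (simp only: power_strict_decreasing_iff)
    then show ?thesis by simp
  qed
  \<comment> \<open>Radii at scale \<open>n\<close> exceed \<open>(1/2) ^ Suc n\<close>, so a cover
    at that size bounds their number by \<open>(2 ^ Suc n) powr s'\<close>. Each term is at most
    \<open>(2 * (1/2) ^ n) powr s\<close>; the exponents add up to
    \<open>s + s' + n * (s' - s)\<close>.\<close>
  have grp: "(\<Sum>i\<in>{i\<in>F. k i = n}. (2 * r i) powr s) \<le> 2 powr (s + s') * q ^ n" if n: "m \<le> n" for n
  proof -
    obtain C where C: "fine_cover X ((1/2) ^ Suc n) C" "real (card C) \<le> (2 ^ Suc n) powr s'"
      using cov[OF n] by blast
    have "card {i\<in>F. k i = n} \<le> card C"
      by (rule card_packing_le_fine_cover[OF pack _ _ _ C(1)]) (use k1 F(2) in \<open>auto intro: less_imp_le\<close>)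
    then have card: "real (card {i\<in>F. k i = n}) \<le> (2 ^ Suc n) powr s'" using C(2) by linarith
    have "(\<Sum>i\<in>{i\<in>F. k i = n}. (2 * r i) powr s) \<le> (\<Sum>i\<in>{i\<in>F. k i = n}. (2 * (1/2) ^ n) powr s)"
      using k2 r s by (intro sum_mono powr_mono2) (auto intro: less_imp_le)
    also have "\<dots> = real (card {i\<in>F. k i = n}) * (2 * (1/2) ^ n) powr s" by simp
    also have "\<dots> \<le> (2 ^ Suc n) powr s' * (2 * (1/2) ^ n) powr s"
      by (intro mult_right_mono card) simp
    also have "(2::real) ^ Suc n = 2 powr (real n + 1)" by (simp add: powr_add powr_realpow)
    also have "2 * (1/2::real) ^ n = 2 powr (1 - real n)"
      by (simp add: powr_diff powr_realpow power_one_over)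
    also have "(2 powr (real n + 1)) powr s' * (2 powr (1 - real n)) powr s
        = 2 powr (s + s') * 2 powr (real n * (s' - s))"
      unfolding powr_powr powr_add[symmetric] by (simp add: algebra_simps)
    also have "2 powr (real n * (s' - s)) = q ^ n"
      unfolding q_def by (simp add: powr_power mult.commute)
    finally show ?thesis .
  qed
  have "(\<Sum>i\<in>F. (2 * r i) powr s) = (\<Sum>n\<in>k ` F. \<Sum>i\<in>{i\<in>F. k i = n}. (2 * r i) powr s)"
    using F(1) by (rule sum.image_gen)
  also have "\<dots> \<le> (\<Sum>n\<in>k ` F. 2 powr (s + s') * q ^ n)"
    using k3 by (intro sum_mono grp) auto
  also have "\<dots> = 2 powr (s + s') * (\<Sum>n\<in>k ` F. q ^ n)" by (simp add: sum_distrib_left)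
  also have "\<dots> \<le> 2 powr (s + s') * (q ^ m / (1 - q))"
    using F k3 by (intro mult_left_mono sum_power_le_geometric_tail q) auto
  finally show ?thesis by (simp add: q_def)
qed

text \<open>An infinite sum of nonnegative terms is the supremum of its finite partial sums, so
  finite subfamilies decide the bound.\<close>

lemma packing_sup_le:
  assumes "\<And>I c r F. packing \<delta> X I c r \<Longrightarrow> finite F \<Longrightarrow> F \<subseteq> I \<Longrightarrow> (\<Sum>i\<in>F. (2 * r i) powr s) \<le> B"
  shows "packing_sup s \<delta> X \<le> ennreal B"
  unfolding packing_sup_def
proof (rule Sup_least, safe)
  fix I c r assume p: "packing \<delta> X I c r"
  show "(\<Sum>\<^sub>\<infinity>i\<in>I. ennreal ((2 * r i) powr s)) \<le> ennreal B"
  proof (rule infsum_le_finite_sums)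
    fix F assume "finite F" "F \<subseteq> I"
    from assms[OF p this] show "(\<Sum>i\<in>F. ennreal ((2 * r i) powr s)) \<le> ennreal B"
      by (simp add: sum_ennreal ennreal_leI)
  qed (simp add: nonneg_summable_on_complete)
qed

lemma packing_premeasure_empty: "packing_premeasure s {} = 0"
proof -
  have "packing_sup s 1 {} \<le> ennreal 0"
    by (rule packing_sup_le) (auto simp: packing_def)
  moreover have "packing_premeasure s {} \<le> packing_sup s 1 {}"
    unfolding packing_premeasure_eq_INF by (rule INF_lower) simp
  ultimately show ?thesis by simp
qed

text \<open>The set \<open>X\<close>, followed by empty sets, is one of the countable covers in the
  infimum.\<close>

lemma packing_measure_le_premeasure:
  assumes "X \<subseteq> M"
  shows "packing_measure s X \<le> packing_premeasure s X"
proof -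
  define Y where "Y j = (if j = 0 then X else {})" for j :: nat
  have "X \<subseteq> (\<Union>j. Y j)" by (auto simp: Y_def intro!: exI[of _ 0])
  then have "packing_measure s X \<le> (\<Sum>j. packing_premeasure s (Y j))"
    unfolding packing_measure_def using assms by (intro INF_lower) (auto simp: Y_def)
  also have "\<dots> = (\<Sum>j\<in>{0}. packing_premeasure s (Y j))"
    by (rule suminf_finite) (auto simp: Y_def packing_premeasure_empty)
  finally show ?thesis by (simp add: Y_def)
qed

text \<open>Below some scale, every \<open>\<alpha>\<close> has a cover by fewer than
  \<open>(1 / \<alpha>) powr s'\<close> sets. At dyadic scales this feeds
  \<open>packing_sum_le\<close>, whose bound vanishes as \<open>m\<close> grows.\<close>

lemma packing_dim_le_upper_box_dim:
  assumes "X \<noteq> {}" "X \<subseteq> M"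
  shows "packing_dim X \<le> upper_box_dim X"
proof (rule dense_ge)
  fix x assume x: "upper_box_dim X < x"
  show "packing_dim X \<le> x"
  proof (cases x)
    case (real s)
    obtain s' where s': "upper_box_dim X < ereal s'" "s' < s"
      using ereal_dense2[OF x] real by auto
    have "0 < s'"
      using s'(1) lower_box_dim_nonneg[OF assms(1)] lower_box_dim_le_upper_box_dim[of X]
      by (metis ereal_less(2) le_less_trans)
    \<comment> \<open>A packing may mix radii of all small sizes, so the bound is needed at every
      small scale; the upper limit supplies it.\<close>
    have "\<forall>\<^sub>F \<alpha> in at_right 0. log_covering_number X \<alpha> / ereal (ln (1 / \<alpha>)) < ereal s'"
      using s'(1) unfolding upper_box_dim_def by (rule Limsup_lessD)
    then obtain \<alpha>\<^sub>0 where \<alpha>\<^sub>0: "\<alpha>\<^sub>0 > 0"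
      "\<And>\<alpha>. 0 < \<alpha> \<Longrightarrow> \<alpha> < \<alpha>\<^sub>0 \<Longrightarrow> log_covering_number X \<alpha> / ereal (ln (1 / \<alpha>)) < ereal s'"
      unfolding eventually_at_right_field by auto
    obtain m\<^sub>0 where m\<^sub>0: "(1/2) ^ m\<^sub>0 < \<alpha>\<^sub>0" using real_arch_pow_inv[of "\<alpha>\<^sub>0" "1/2"] \<alpha>\<^sub>0(1) by auto
    have cov: "\<exists>C. fine_cover X ((1/2) ^ Suc k) C \<and> real (card C) \<le> (2 ^ Suc k) powr s'"
      if "m\<^sub>0 \<le> k" for k
    proof -
      have "(1/2::real) ^ Suc k \<le> (1/2) ^ m\<^sub>0" using that by (intro power_decreasing) auto
      then have "log_covering_number X ((1/2) ^ Suc k) / ereal (ln (1 / (1/2) ^ Suc k)) < ereal s'"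
        using m\<^sub>0 by (intro \<alpha>\<^sub>0(2)) auto
      moreover have "(1/2::real) ^ Suc k < 1" by (rule power_Suc_less_one) auto
      ultimately show ?thesis
        using log_covering_ratio_less_iff[OF assms(1), of "(1/2) ^ Suc k" s']
        by (auto simp: power_one_over intro: less_imp_le)
    qed
    define q :: real where "q = 2 powr (s' - s)"
    have q: "0 \<le> q" "q < 1" using s' by (auto simp: q_def powr_less_one)
    have le: "packing_premeasure s X \<le> ennreal (2 powr (s + s') * (q ^ m / (1 - q)))" if "m\<^sub>0 \<le> m" for m
    proof -
      have "packing_premeasure s X \<le> packing_sup s ((1/2) ^ m) X"
        unfolding packing_premeasure_eq_INF by (intro INF_lower) auto
      also have "\<dots> \<le> ennreal (2 powr (s + s') * (q ^ m / (1 - q)))"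
      proof (rule packing_sup_le)
        fix I c r F assume *: "packing ((1/2) ^ m) X I c r" "finite F" "F \<subseteq> I"
        show "(\<Sum>i\<in>F. (2 * r i) powr s) \<le> 2 powr (s + s') * (q ^ m / (1 - q))"
          unfolding q_def
          by (rule packing_sum_le[OF less_imp_le[OF \<open>0 < s'\<close>] s'(2) cov *]) (use that in linarith)
      qed
      finally show ?thesis .
    qed
    have "(\<lambda>m. ennreal (2 powr (s + s') * (q ^ m / (1 - q)))) \<longlonglongrightarrow> ennreal (2 powr (s + s') * (0 / (1 - q)))"
      using LIMSEQ_realpow_zero[OF q]
      by (intro tendsto_ennrealI tendsto_mult_left tendsto_divide tendsto_const) (use q in auto)
    then have "packing_premeasure s X \<le> ennreal (2 powr (s + s') * (0 / (1 - q)))"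
      by (rule LIMSEQ_le_const) (use le in blast)
    then have "packing_measure s X = 0"
      using packing_measure_le_premeasure[OF assms(2), of s] by simp
    then show ?thesis
      unfolding packing_dim_def using \<open>0 < s'\<close> s'(2) real by (intro Inf_lower) auto
  qed (use x in auto)
qed

end

section \<open>Trees and their paths\<close>

lemma map_upt_eq_iff: "map f [0..<n] = map g [0..<n] \<longleftrightarrow> (\<forall>k<n. f k = g k)"
  by auto

lemma take_map_upt: "m \<le> n \<Longrightarrow> take m (map f [0..<n]) = map f [0..<m]"
  by (simp add: take_map)

lemma prefix_closed: "tree T \<Longrightarrow> \<tau> \<in> T \<Longrightarrow> prefix \<sigma> \<tau> \<Longrightarrow> \<sigma> \<in> T"
  by (auto simp: tree_def)

lemma path_of_strict_prefix_chain:
  assumes "tree S" "\<And>n. \<sigma> n \<in> S" "\<And>n. strict_prefix (\<sigma> n) (\<sigma> (Suc n))"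
  obtains f where "f \<in> paths S" "\<And>n. map f [0..<length (\<sigma> n)] = \<sigma> n"
proof
  \<comment> \<open>Lengths grow by at least one per step, so \<open>\<sigma> (Suc k)\<close> has an
    entry at position \<open>k\<close>; the prefix relation makes the choice of string
    immaterial.\<close>
  define f where "f k = \<sigma> (Suc k) ! k" for k
  have pre: "prefix (\<sigma> m) (\<sigma> n)" if "m \<le> n" for m n
    using that by (induction rule: dec_induct) (use assms(3) in \<open>auto simp: strict_prefix_def intro: prefix_order.trans\<close>)
  have len: "n \<le> length (\<sigma> n)" for n
  proof (induction n)
    case (Suc n)
    then show ?case using prefix_length_less[OF assms(3)[of n]] by simp
  qed simp
  have nth: "f k = \<sigma> n ! k" if "k < length (\<sigma> n)" for k n
  proof (cases "n \<le> Suc k")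
    case True
    from pre[OF True] that show ?thesis by (auto simp: f_def prefix_def nth_append)
  next
    case False
    then have "prefix (\<sigma> (Suc k)) (\<sigma> n)" by (intro pre) auto
    moreover have "k < length (\<sigma> (Suc k))" using len[of "Suc k"] by simp
    ultimately show ?thesis by (auto simp: f_def prefix_def nth_append)
  qed
  show eq: "map f [0..<length (\<sigma> n)] = \<sigma> n" for n
    by (rule nth_equalityI) (auto simp: nth)
  have "map f [0..<n] \<in> S" for n
  proof -
    have "map f [0..<n] = take n (\<sigma> n)" using eq[of n] len[of n] take_map_upt by metis
    then show ?thesis using prefix_closed[OF assms(1) assms(2)[of n]] take_is_prefix by metis
  qed
  then show "f \<in> paths S" by (simp add: paths_def)
qed

definition extensions :: "nat list set \<Rightarrow> nat list \<Rightarrow> nat \<Rightarrow> nat list set" where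
  "extensions T \<sigma> n = {\<tau> \<in> level T n. prefix \<sigma> \<tau>}"

lemma level_eq_extensions: "level T n = extensions T [] n"
  by (simp add: extensions_def)

text \<open>Deleting the last entry sends each extension to a unique one of length \<open>n\<close>,
  so the successor sets partition the next level. The case \<open>\<sigma> = []\<close> counts whole
  levels.\<close>

lemma card_extensions_Suc:
  assumes "tree T" "finitely_branching T" "length \<sigma> \<le> n"
  shows "card (extensions T \<sigma> (Suc n)) = (\<Sum>\<tau>\<in>extensions T \<sigma> n. card (succs T \<tau>))"
proof -
  have "extensions T \<sigma> (Suc n) = (\<Union>\<tau>\<in>extensions T \<sigma> n. succs T \<tau>)"
  proof (intro equalityI subsetI)
    fix \<tau> assume \<tau>: "\<tau> \<in> extensions T \<sigma> (Suc n)"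
    then obtain \<rho> k where \<rho>: "\<tau> = \<rho> @ [k]"
      by (cases \<tau> rule: rev_cases) (auto simp: extensions_def level_def)
    then have "\<rho> \<in> T" using \<tau> prefix_closed[OF assms(1), of \<tau> \<rho>] by (auto simp: extensions_def level_def)
    moreover have "prefix \<sigma> \<rho>" using \<tau> \<rho> assms(3) by (auto simp: extensions_def level_def)
    ultimately show "\<tau> \<in> (\<Union>\<tau>\<in>extensions T \<sigma> n. succs T \<tau>)"
      using \<tau> \<rho> by (auto simp: extensions_def level_def succs_def)
  qed (auto simp: extensions_def level_def succs_def)
  moreover have "finite (extensions T \<sigma> n)"
    using finite_level[OF assms(1,2)] by (simp add: extensions_def)
  moreover have "\<forall>\<tau>\<in>extensions T \<sigma> n. finite (succs T \<tau>)"
    using assms(2) by (auto simp: extensions_def level_def finitely_branching_def)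
  moreover have "\<forall>\<tau>\<in>extensions T \<sigma> n. \<forall>\<rho>\<in>extensions T \<sigma> n. \<tau> \<noteq> \<rho> \<longrightarrow> succs T \<tau> \<inter> succs T \<rho> = {}"
    by (auto simp: succs_def)
  ultimately show ?thesis by (simp add: card_UN_disjoint)
qed

definition cylinder :: "nat list set \<Rightarrow> nat list \<Rightarrow> (nat \<Rightarrow> nat) set" where
  "cylinder T \<sigma> = {f \<in> paths T. map f [0..<length \<sigma>] = \<sigma>}"

section \<open>Uniformly branching subtrees\<close>

locale uniform_subtree =
  fixes S T :: "nat list set"
  assumes tree_S: "tree S" and tree_T: "tree T" and S_subset_T: "S \<subseteq> T"
    and no_leaves_S: "no_leaves S"
    and finitely_branching_T: "finitely_branching T"
    and card_succs_T: "\<And>\<sigma>. \<sigma> \<in> T \<Longrightarrow> 2 \<le> card (succs T \<sigma>)"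
    and uniformly_branching_S: "uniformly_branching S"
begin

sublocale Metric_space "paths T" "path_dist T"
  using tree_T finitely_branching_T by (rule Metric_space_paths)

abbreviation t :: "nat \<Rightarrow> nat" where "t n \<equiv> card (level T n)"
abbreviation s :: "nat \<Rightarrow> nat" where "s n \<equiv> card (level S n)"

section \<open>Sizes of the levels\<close>

lemma finitely_branching_S: "finitely_branching S"
  unfolding finitely_branching_def
proof
  fix \<sigma> assume "\<sigma> \<in> S"
  have "succs S \<sigma> \<subseteq> succs T \<sigma>" using S_subset_T by (auto simp: succs_def)
  moreover have "finite (succs T \<sigma>)"
    using \<open>\<sigma> \<in> S\<close> S_subset_T finitely_branching_T by (auto simp: finitely_branching_def)
  ultimately show "finite (succs S \<sigma>)" by (rule finite_subset)
qed

lemma Nil_mem_S: "[] \<in> S"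
  using tree_S by (auto simp: tree_def)

lemma level_S_nonempty: "level S n \<noteq> {}"
proof (induction n)
  case 0
  then show ?case using Nil_mem_S by (auto simp: level_def)
next
  case (Suc n)
  then show ?case using no_leaves_S by (force simp: level_def no_leaves_def succs_def)
qed

lemma s_pos: "0 < s n"
  using level_S_nonempty finite_level[OF tree_S finitely_branching_S] by (simp add: card_gt_0_iff)

lemma t_pos: "0 < t n"
proof -
  have "level S n \<subseteq> level T n" using S_subset_T by (auto simp: level_def)
  then show ?thesis
    using level_S_nonempty[of n] finite_level[OF tree_T finitely_branching_T] by (auto simp: card_gt_0_iff)
qed

lemma s_0: "s 0 = 1"
proof -
  have "level S 0 = {[]}" using Nil_mem_S by (auto simp: level_def)
  then show ?thesis by simp
qed

text \<open>Here the two successors of each node of \<open>T\<close> enter. They make the scales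
  \<open>1 / t n\<close> strictly decreasing with limit 0.\<close>

lemma two_mult_t_le: "2 * t n \<le> t (Suc n)"
proof -
  have "t (Suc n) = (\<Sum>\<tau>\<in>level T n. card (succs T \<tau>))"
    unfolding level_eq_extensions using tree_T finitely_branching_T by (intro card_extensions_Suc) auto
  also have "\<dots> \<ge> (\<Sum>\<tau>\<in>level T n. 2)"
    by (intro sum_mono card_succs_T) (simp add: level_def)
  finally show ?thesis by simp
qed

lemma strict_mono_t: "strict_mono t"
  unfolding strict_mono_Suc_iff
proof
  fix n show "t n < t (Suc n)" using two_mult_t_le[of n] t_pos[of n] by linarith
qed

lemma power_2_le_t: "2 ^ n \<le> t n"
proof (induction n)
  case 0
  then show ?case using t_pos[of 0] by simp
next
  case (Suc n)
  then show ?case using two_mult_t_le[of n] by simp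
qed

lemma inverse_t_le_iff: "1 / real (t m) \<le> 1 / real (t n) \<longleftrightarrow> n \<le> m"
  using t_pos[of m] t_pos[of n] strict_mono_less_eq[OF strict_mono_t, of n m]
  by (simp add: divide_simps)

lemma ex_inverse_t_less:
  fixes \<alpha> :: real
  assumes "0 < \<alpha>"
  shows "\<exists>n. 1 / real (t n) < \<alpha>"
proof -
  obtain n where n: "(1/2) ^ n < \<alpha>" using real_arch_pow_inv[of \<alpha> "1/2"] assms by auto
  have "2 ^ n \<le> real (t n)" using power_2_le_t[of n] by (metis of_nat_le_iff of_nat_numeral of_nat_power)
  then have "1 / real (t n) \<le> 1 / 2 ^ n" using t_pos[of n] by (intro divide_left_mono) auto
  also have "1 / 2 ^ n < \<alpha>" using n by (simp add: power_one_over)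
  finally show ?thesis by blast
qed

lemma card_succs_S:
  assumes "\<sigma> \<in> level S n" "\<tau> \<in> level S n"
  shows "card (succs S \<sigma>) = card (succs S \<tau>)"
  using assms uniformly_branching_S unfolding uniformly_branching_def eqpoll_def
  by (meson bij_betw_same_card)

text \<open>Passing to the next level multiplies the number of extensions of \<open>\<sigma>\<close>
  and the size of the whole level by the same branching number. So every node of level
  \<open>k\<close> carries the same share of level \<open>n\<close>.\<close>

lemma card_extensions_mult_s:
  assumes "\<sigma> \<in> level S k" "k \<le> n"
  shows "card (extensions S \<sigma> n) * s k = s n"
  using assms(2)
proof (induction rule: dec_induct)
  case base
  have "extensions S \<sigma> k = {\<sigma>}"
    using assms(1) by (auto simp: extensions_def level_def prefix_def)
  then show ?case by simp
next
  case (step n)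
  obtain \<rho> where \<rho>: "\<rho> \<in> level S n" using level_S_nonempty[of n] by auto
  have len: "length \<sigma> \<le> n" using assms(1) step by (simp add: level_def)
  have *: "card (extensions S \<tau> (Suc n)) = card (extensions S \<tau> n) * card (succs S \<rho>)"
    if "length \<tau> \<le> n" for \<tau>
  proof -
    have "card (extensions S \<tau> (Suc n)) = (\<Sum>\<upsilon>\<in>extensions S \<tau> n. card (succs S \<upsilon>))"
      by (rule card_extensions_Suc[OF tree_S finitely_branching_S that])
    also have "\<dots> = (\<Sum>\<upsilon>\<in>extensions S \<tau> n. card (succs S \<rho>))"
      by (intro sum.cong[OF refl] card_succs_S[OF _ \<rho>]) (simp add: extensions_def)
    finally show ?thesis by simp
  qed
  show ?case
    using *[OF len] *[of "[]"] step.IH by (simp add: level_eq_extensions[symmetric] mult_ac)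
qed

section \<open>Cylinders as covers\<close>

lemma path_dist_le:
  assumes "\<And>k. k < n \<Longrightarrow> f k = g k"
  shows "path_dist T f g \<le> 1 / real (t n)"
  unfolding path_dist_def
proof (rule cSup_least)
  fix x assume "x \<in> insert 0 {1 / real (t m) | m. f m \<noteq> g m}"
  then consider "x = 0" | m where "x = 1 / real (t m)" "f m \<noteq> g m" by blast
  then show "x \<le> 1 / real (t n)"
  proof cases
    case 2
    then show ?thesis using assms[of m] inverse_t_le_iff[of m n] by (auto simp: not_less[symmetric])
  qed simp
qed simp

lemma fine_cover_cylinders:
  assumes "1 / real (t n) \<le> \<alpha>"
  shows "fine_cover (paths S) \<alpha> (cylinder T ` level S n)"
  unfolding fine_cover_def
proof (intro conjI ballI)
  show "finite (cylinder T ` level S n)"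
    using finite_level[OF tree_S finitely_branching_S] by simp
  show "paths S \<subseteq> \<Union> (cylinder T ` level S n)"
  proof
    fix f assume f: "f \<in> paths S"
    then have "f \<in> cylinder T (map f [0..<n])" "map f [0..<n] \<in> level S n"
      using S_subset_T by (auto simp: cylinder_def paths_def level_def)
    then show "f \<in> \<Union> (cylinder T ` level S n)" by blast
  qed
  fix A assume "A \<in> cylinder T ` level S n"
  then obtain \<sigma> where \<sigma>: "\<sigma> \<in> level S n" "A = cylinder T \<sigma>" by blast
  show "A \<subseteq> paths T" using \<sigma> by (auto simp: cylinder_def)
  have "path_dist T f g \<le> \<alpha>" if "f \<in> A" "g \<in> A" for f g
  proof -
    have "map f [0..<n] = map g [0..<n]" using that \<sigma> by (auto simp: cylinder_def level_def)
    then have "path_dist T f g \<le> 1 / real (t n)" by (intro path_dist_le) auto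
    then show ?thesis using assms by linarith
  qed
  moreover have "0 \<le> \<alpha>" using order_trans[OF _ assms] by simp
  ultimately show "ediam A \<le> ennreal \<alpha>" using ediam_le_iff by blast
qed

lemma paths_S_subset: "paths S \<subseteq> paths T"
  using S_subset_T by (auto simp: paths_def)

lemma ex_succ_S:
  assumes "\<sigma> \<in> S"
  obtains k where "\<sigma> @ [k] \<in> S"
  using assms no_leaves_S by (auto simp: no_leaves_def succs_def)

lemma paths_S_nonempty: "paths S \<noteq> {}"
proof -
  have "\<exists>\<sigma>. \<forall>n. \<sigma> n \<in> S \<and> strict_prefix (\<sigma> n) (\<sigma> (Suc n))"
  proof (rule dependent_nat_choice)
    fix \<sigma> assume "\<sigma> \<in> S"
    then obtain k where "\<sigma> @ [k] \<in> S" by (rule ex_succ_S)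
    then show "\<exists>\<tau>. \<tau> \<in> S \<and> strict_prefix \<sigma> \<tau>"
      by (intro exI[of _ "\<sigma> @ [k]"]) (simp add: strict_prefix_def)
  qed (use Nil_mem_S in auto)
  then obtain \<sigma> where "\<And>n. \<sigma> n \<in> S" "\<And>n. strict_prefix (\<sigma> n) (\<sigma> (Suc n))" by blast
  then obtain f where "f \<in> paths S" by (rule path_of_strict_prefix_chain[OF tree_S])
  then show ?thesis by blast
qed

text \<open>The cylinders of level \<open>n\<close> form a cover at scale \<open>\<alpha>\<close>,
  so a lower bound on the covering number is one on \<open>s n\<close>.\<close>

lemma powr_le_s:
  assumes "0 < \<alpha>" "\<alpha> < 1" "1 / real (t n) \<le> \<alpha>"
    and "ereal a < log_covering_number (paths S) \<alpha> / ereal (ln (1 / \<alpha>))"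
  shows "(1 / \<alpha>) powr a \<le> real (s n)"
proof -
  have "\<not> (log_covering_number (paths S) \<alpha> / ereal (ln (1 / \<alpha>)) < ereal a)"
    using assms(4) by simp
  then have "(1 / \<alpha>) powr a \<le> real (card (cylinder T ` level S n))"
    using fine_cover_cylinders[OF assms(3)]
    unfolding log_covering_ratio_less_iff[OF paths_S_nonempty assms(1,2)] by (auto simp: not_less)
  also have "\<dots> \<le> real (s n)"
    using card_image_le[OF finite_level[OF tree_S finitely_branching_S]] by simp
  finally show ?thesis .
qed

section \<open>Lower bound for the Hausdorff dimension\<close>

text \<open>The mass distribution principle for the uniform mass \<open>1 / s n\<close> of cylinders at level
  \<open>n\<close>, without a measure: if the total weight were less than \<open>1\<close>, one could descend along nodes
  \<open>\<sigma>\<close> for which the weights of the strings extending \<open>\<sigma>\<close> sum to less than the mass of \<open>\<sigma>\<close>, and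
  the resulting path would not be covered.\<close>

lemma total_weight_ge_1:
  fixes w :: "nat \<Rightarrow> ennreal" and \<tau> :: "nat \<Rightarrow> nat list"
  assumes "\<And>f. f \<in> paths S \<Longrightarrow>
    \<exists>i. map f [0..<length (\<tau> i)] = \<tau> i \<and> ennreal (1 / real (s (length (\<tau> i)))) \<le> w i"
  shows "1 \<le> (\<Sum>i. w i)"
proof (rule ccontr)
  assume less: "\<not> 1 \<le> (\<Sum>i. w i)"
  define m where "m \<sigma> = (\<Sum>i. if prefix \<sigma> (\<tau> i) then w i else 0)" for \<sigma>
  have "\<exists>\<sigma>. \<forall>n. (\<sigma> n \<in> level S n \<and> m (\<sigma> n) < ennreal (1 / real (s n))) \<and> strict_prefix (\<sigma> n) (\<sigma> (Suc n))"
  proof (rule dependent_nat_choice)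
    show "\<exists>\<sigma>. \<sigma> \<in> level S 0 \<and> m \<sigma> < ennreal (1 / real (s 0))"
      unfolding s_0 using Nil_mem_S less by (intro exI[of _ "[]"]) (simp add: level_def m_def not_le)
  next
    fix \<sigma> n assume \<sigma>: "\<sigma> \<in> level S n \<and> m \<sigma> < ennreal (1 / real (s n))"
    have fin: "finite (succs S \<sigma>)"
      using \<sigma> finitely_branching_S by (simp add: finitely_branching_def level_def)
    \<comment> \<open>Otherwise summing over the successors, whose masses add up to
      \<open>1 / s n\<close> by uniform branching, would give
      \<open>1 / s n \<le> m \<sigma>\<close>.\<close>
    have "\<exists>\<rho>\<in>succs S \<sigma>. m \<rho> < ennreal (1 / real (s (Suc n)))"
    proof (rule ccontr)
      assume "\<not> ?thesis"
      then have ge: "ennreal (1 / real (s (Suc n))) \<le> m \<rho>" if "\<rho> \<in> succs S \<sigma>" for \<rho>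
        using that by (auto simp: not_less)
      have "extensions S \<sigma> (Suc n) = succs S \<sigma>"
        using \<sigma> by (auto simp: extensions_def succs_def level_def prefix_def length_Suc_conv[of _ 0])
      then have card: "card (succs S \<sigma>) * s n = s (Suc n)"
        using card_extensions_mult_s[of \<sigma> n "Suc n"] \<sigma> by simp
      have "1 / real (s n) = real (card (succs S \<sigma>)) * (1 / real (s (Suc n)))"
        using s_pos[of n] s_pos[of "Suc n"] arg_cong[OF card, of real] by (simp add: field_simps)
      then have "ennreal (1 / real (s n)) = (\<Sum>\<rho>\<in>succs S \<sigma>. ennreal (1 / real (s (Suc n))))"
        by (simp flip: ennreal_mult add: ennreal_of_nat_eq_real_of_nat)
      also have "\<dots> \<le> (\<Sum>\<rho>\<in>succs S \<sigma>. m \<rho>)" by (intro sum_mono ge)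
      also have "\<dots> = (\<Sum>i. \<Sum>\<rho>\<in>succs S \<sigma>. if prefix \<rho> (\<tau> i) then w i else 0)"
        unfolding m_def by (rule suminf_sum[symmetric]) simp
      also have "\<dots> \<le> m \<sigma>"
        unfolding m_def
      proof (intro suminf_le summableI)
        fix i
        show "(\<Sum>\<rho>\<in>succs S \<sigma>. if prefix \<rho> (\<tau> i) then w i else 0) \<le> (if prefix \<sigma> (\<tau> i) then w i else 0)"
        proof (cases "\<exists>\<rho>\<in>succs S \<sigma>. prefix \<rho> (\<tau> i)")
          case True
          then obtain \<rho> where \<rho>: "\<rho> \<in> succs S \<sigma>" "prefix \<rho> (\<tau> i)" by blast
          \<comment> \<open>Distinct successors are incomparable, so each weight is counted for at
            most one of them.\<close>
          have "\<not> prefix \<rho>' (\<tau> i)" if "\<rho>' \<in> succs S \<sigma> - {\<rho>}" for \<rho>'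
            using that \<rho> prefix_same_cases[of \<rho> "\<tau> i" \<rho>'] by (auto simp: succs_def)
          then have "(\<Sum>\<rho>\<in>succs S \<sigma>. if prefix \<rho> (\<tau> i) then w i else 0)
              = (\<Sum>\<rho>\<in>{\<rho>}. if prefix \<rho> (\<tau> i) then w i else 0)"
            using fin \<rho>(1) by (intro sum.mono_neutral_right) auto
          moreover have "prefix \<sigma> (\<tau> i)"
            using \<rho> by (auto simp: succs_def dest: append_prefixD)
          ultimately show ?thesis using \<rho>(2) by simp
        qed (simp add: sum.neutral)
      qed
      finally show False using \<sigma> not_le by blast
    qed
    then show "\<exists>\<rho>. (\<rho> \<in> level S (Suc n) \<and> m \<rho> < ennreal (1 / real (s (Suc n)))) \<and> strict_prefix \<sigma> \<rho>"
      using \<sigma> by (auto simp: succs_def level_def strict_prefix_def)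
  qed
  then obtain \<sigma> where \<sigma>: "\<And>n. \<sigma> n \<in> level S n" "\<And>n. m (\<sigma> n) < ennreal (1 / real (s n))"
    "\<And>n. strict_prefix (\<sigma> n) (\<sigma> (Suc n))" by blast
  have len: "length (\<sigma> n) = n" for n using \<sigma>(1)[of n] by (simp add: level_def)
  have \<sigma>_S: "\<sigma> n \<in> S" for n using \<sigma>(1)[of n] by (simp add: level_def)
  obtain f where f: "f \<in> paths S" "\<And>n. map f [0..<length (\<sigma> n)] = \<sigma> n"
    using path_of_strict_prefix_chain[of S \<sigma>, OF tree_S \<sigma>_S \<sigma>(3)] by metis
  obtain i where i: "map f [0..<length (\<tau> i)] = \<tau> i" "ennreal (1 / real (s (length (\<tau> i)))) \<le> w i"
    using assms[OF f(1)] by blast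
  \<comment> \<open>Both are the initial segment of \<open>f\<close> of this length. So
    \<open>w i\<close> alone already pushes \<open>m\<close> up to the mass of that node.\<close>
  have "\<sigma> (length (\<tau> i)) = \<tau> i" using f(2)[of "length (\<tau> i)"] i(1) by (simp add: len)
  then have "w i = (\<Sum>j\<in>{i}. if prefix (\<sigma> (length (\<tau> i))) (\<tau> j) then w j else 0)" by simp
  also have "\<dots> \<le> m (\<sigma> (length (\<tau> i)))"
    unfolding m_def by (rule sum_le_suminf) auto
  finally show False using i(2) \<sigma>(2)[of "length (\<tau> i)"] by simp
qed

text \<open>A singleton has diameter \<open>0\<close> but no cylinder has mass \<open>0\<close>, hence the error term.\<close>

lemma ex_cylinder_mass_le_diam_powr:
  assumes "0 \<le> a" "\<And>n. N \<le> n \<Longrightarrow> real (t n) powr a \<le> real (s n)"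
    and "U \<noteq> {}" "ediam U \<le> ennreal (1 / real (t N))" "0 < e"
  obtains \<tau> where "\<And>f. f \<in> U \<Longrightarrow> map f [0..<length \<tau>] = \<tau>"
    "ennreal (1 / real (s (length \<tau>))) \<le> diam_powr U a + ennreal e"
proof -
  obtain h where h: "h \<in> U" using assms(3) by blast
  \<comment> \<open>For \<open>a = 0\<close> the root, of mass 1, serves; otherwise \<open>U\<close>
    has two distinct members or is the singleton of \<open>h\<close>.\<close>
  consider "a = 0" | "0 < a" "\<exists>n. \<exists>f\<in>U. \<exists>g\<in>U. f n \<noteq> g n" | "0 < a" "\<And>f. f \<in> U \<Longrightarrow> f = h"
    using assms(1) h by fastforce
  then show thesis
  proof cases
    case 1
    have "diam_powr U a = 1" using 1 assms(3) by (simp add: diam_powr_def)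
    then show thesis by (intro that[of "[]"]) (auto simp: s_0)
  next
    case 2
    \<comment> \<open>All members of \<open>U\<close> agree before this first splitting position, so
      \<open>U\<close> lies in a cylinder of level \<open>n\<close>, while its diameter is at least
      \<open>1 / t n\<close>. The bound on the diameter forces \<open>N \<le> n\<close>.\<close>
    define n where "n = (LEAST n. \<exists>f\<in>U. \<exists>g\<in>U. f n \<noteq> g n)"
    obtain f g where fg: "f \<in> U" "g \<in> U" "f n \<noteq> g n"
      using LeastI_ex[OF 2(2)] unfolding n_def by blast
    have agree: "f k = h k" if "f \<in> U" "k < n" for f k
      using not_less_Least[of k "\<lambda>n. \<exists>f\<in>U. \<exists>g\<in>U. f n \<noteq> g n"] that h unfolding n_def by blast
    have "ennreal (1 / real (t n)) \<le> ennreal (path_dist T f g)"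
      by (rule ennreal_leI, rule path_dist_upper, rule fg(3))
    also have "\<dots> \<le> ediam U"
      unfolding ediam_def by (rule SUP_upper2[OF fg(1)], rule SUP_upper2[OF fg(2)]) simp
    finally have le: "ennreal (1 / real (t n)) \<le> ediam U" .
    then have "ennreal (1 / real (t n)) \<le> ennreal (1 / real (t N))" using assms(4) by (rule order_trans)
    then have "1 / real (t n) \<le> 1 / real (t N)" by (subst (asm) ennreal_le_iff) auto
    then have "N \<le> n" unfolding inverse_t_le_iff .
    have "ediam U < top" using assms(4) by (rule le_less_trans) simp
    then have "1 / real (t n) \<le> enn2real (ediam U)"
      using le enn2real_mono[OF le] by simp
    then have "(1 / real (t n)) powr a \<le> enn2real (ediam U) powr a"
      using 2(1) by (intro powr_mono2) auto
    moreover have "1 / real (s n) \<le> 1 / real (t n) powr a"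
      using assms(2)[OF \<open>N \<le> n\<close>] t_pos[of n] by (intro divide_left_mono) (auto simp: s_pos)
    ultimately have "ennreal (1 / real (s n)) \<le> diam_powr U a"
      using 2(1) h by (auto simp: diam_powr_def powr_divide intro!: ennreal_leI)
    then have "ennreal (1 / real (s n)) \<le> diam_powr U a + ennreal e"
      by (rule order_trans) simp
    then show thesis using agree by (intro that[of "map h [0..<n]"]) auto
  next
    case 3
    have "1 < 2 powr a" using 3(1) by simp
    \<comment> \<open>Since \<open>2 ^ m \<le> t m\<close>, the sizes \<open>s m\<close> grow at
      least like \<open>(2 powr a) ^ m\<close>. A long enough initial segment of the single path
      thus has mass at most \<open>e\<close>; adding \<open>N\<close> keeps the growth hypothesis
      applicable.\<close>
    then obtain n where n: "1 / e < (2 powr a) ^ n" using real_arch_pow by blast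
    note n
    also have "(2 powr a) ^ n \<le> (2 powr a) ^ (n + N)"
      using \<open>1 < 2 powr a\<close> by (intro power_increasing) auto
    also have "\<dots> = (2 ^ (n + N)) powr a" by (simp add: powr_power powr_realpow[symmetric] powr_powr mult.commute del: power_add)
    also have "\<dots> \<le> real (t (n + N)) powr a"
    proof (rule powr_mono2)
      show "2 ^ (n + N) \<le> real (t (n + N))"
        using power_2_le_t[of "n + N"] by (metis of_nat_le_iff of_nat_numeral of_nat_power)
    qed (use 3 in auto)
    also have "\<dots> \<le> real (s (n + N))" by (rule assms(2)) simp
    finally have "1 / real (s (n + N)) \<le> e"
      using assms(5) s_pos[of "n + N"] by (simp add: field_simps)
    then have "ennreal (1 / real (s (n + N))) \<le> diam_powr U a + ennreal e"
      by (rule order_trans[OF ennreal_leI]) simp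
    moreover have "map f [0..<length (map h [0..<n + N])] = map h [0..<n + N]" if "f \<in> U" for f
      using 3(2)[OF that] by simp
    ultimately show thesis by (intro that[of "map h [0..<n + N]"]) (simp_all only: length_map length_upt diff_zero)
  qed
qed

text \<open>If \<open>a\<close> were below the lower box dimension, then
  \<open>t n powr a \<le> s n\<close> for all large \<open>n\<close>. Enclosing the members of a
  cover of small weight in cylinders would then contradict \<open>total_weight_ge_1\<close>.\<close>

lemma lower_box_dim_le_hausdorff_dim: "lower_box_dim (paths S) \<le> hausdorff_dim (paths S)"
  unfolding hausdorff_dim_def
proof (rule Inf_greatest, safe)
  fix a :: real assume a: "0 \<le> a" "hausdorff_measure a (paths S) = 0"
  show "lower_box_dim (paths S) \<le> ereal a"
  proof (rule ccontr)
    assume "\<not> ?thesis"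
    then have "\<forall>\<^sub>F \<alpha> in at_right 0. ereal a < log_covering_number (paths S) \<alpha> / ereal (ln (1 / \<alpha>))"
      unfolding lower_box_dim_def not_le by (rule less_LiminfD)
    then obtain \<alpha>\<^sub>0 where \<alpha>\<^sub>0: "\<alpha>\<^sub>0 > 0"
      "\<And>\<alpha>. 0 < \<alpha> \<Longrightarrow> \<alpha> < \<alpha>\<^sub>0 \<Longrightarrow> ereal a < log_covering_number (paths S) \<alpha> / ereal (ln (1 / \<alpha>))"
      unfolding eventually_at_right_field by auto
    obtain N where N: "1 / real (t N) < min \<alpha>\<^sub>0 1"
      using ex_inverse_t_less[of "min \<alpha>\<^sub>0 1"] \<alpha>\<^sub>0(1) by auto
    have le_s: "real (t n) powr a \<le> real (s n)" if "N \<le> n" for n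
    proof -
      have "1 / real (t n) < min \<alpha>\<^sub>0 1" using N inverse_t_le_iff[of n N] that by linarith
      then have "(1 / (1 / real (t n))) powr a \<le> real (s n)"
        using t_pos[of n] by (intro powr_le_s \<alpha>\<^sub>0(2)) auto
      then show ?thesis by simp
    qed
    have "hausdorff_premeasure a (1 / real (t N)) (paths S) \<le> hausdorff_measure a (paths S)"
      unfolding hausdorff_measure_def using t_pos[of N] by (intro SUP_upper) simp
    also have "\<dots> < ennreal (1/2)" unfolding a(2) by (subst ennreal_0[symmetric], subst ennreal_less_iff) auto
    finally obtain U where U: "paths S \<subseteq> (\<Union>i. U i)"
      "\<And>i. ediam (U i) \<le> ennreal (1 / real (t N))" "(\<Sum>i. diam_powr (U i) a) < ennreal (1/2)"
      unfolding hausdorff_premeasure_def INF_less_iff by auto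
    \<comment> \<open>These errors sum to \<open>1/2\<close>, and the weights of the cover to less
      than \<open>1/2\<close>, so the total stays below 1.\<close>
    define e :: "nat \<Rightarrow> real" where "e i = (1/2) * (1/2) ^ Suc i" for i
    have "\<exists>\<tau>. U i \<noteq> {} \<longrightarrow> (\<forall>f\<in>U i. map f [0..<length \<tau>] = \<tau>) \<and>
      ennreal (1 / real (s (length \<tau>))) \<le> diam_powr (U i) a + ennreal (e i)" for i
    proof (cases "U i = {}")
      case False
      have "0 < e i" by (simp add: e_def)
      from ex_cylinder_mass_le_diam_powr[OF a(1) le_s False U(2) this] show ?thesis by metis
    qed simp
    then obtain \<tau> where \<tau>: "\<And>i. U i \<noteq> {} \<Longrightarrow> (\<forall>f\<in>U i. map f [0..<length (\<tau> i)] = \<tau> i) \<and>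
      ennreal (1 / real (s (length (\<tau> i)))) \<le> diam_powr (U i) a + ennreal (e i)" by metis
    have "1 \<le> (\<Sum>i. diam_powr (U i) a + ennreal (e i))"
    proof (rule total_weight_ge_1)
      fix f assume "f \<in> paths S"
      then obtain i where "f \<in> U i" using U(1) by blast
      then show "\<exists>i. map f [0..<length (\<tau> i)] = \<tau> i \<and>
          ennreal (1 / real (s (length (\<tau> i)))) \<le> diam_powr (U i) a + ennreal (e i)"
        using \<tau>[of i] by blast
    qed
    also have "\<dots> = (\<Sum>i. diam_powr (U i) a) + (\<Sum>i. ennreal (e i))"
      by (rule suminf_add[symmetric]) auto
    also have "(\<Sum>i. ennreal (e i)) = ennreal (1/2)"
    proof (rule suminf_ennreal_eq)
      show "e sums (1/2)" unfolding e_def using sums_mult[OF power_half_series, of "1/2"] by simp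
    qed (simp add: e_def)
    also have "(\<Sum>i. diam_powr (U i) a) + ennreal (1/2) = ennreal (1/2) + (\<Sum>i. diam_powr (U i) a)"
      by (rule add.commute)
    also have "\<dots> < ennreal (1/2) + ennreal (1/2)"
      unfolding ennreal_add_left_cancel_less using U(3) by simp
    also have "\<dots> = ennreal (1/2 + 1/2)" by (rule ennreal_plus[symmetric]) auto
    also have "\<dots> = 1" by simp
    finally show False by simp
  qed
qed

section \<open>Lower bound for the packing dimension\<close>

text \<open>The Baire category theorem for \<open>paths S\<close>.\<close>

lemma ex_dense_in_cylinder:
  fixes Y :: "nat \<Rightarrow> (nat \<Rightarrow> nat) set"
  assumes "paths S \<subseteq> (\<Union>j. Y j)"
  obtains (dense) j \<sigma> where "\<sigma> \<in> S"
    "\<And>\<tau>. \<tau> \<in> S \<Longrightarrow> prefix \<sigma> \<tau> \<Longrightarrow> \<exists>f\<in>Y j. map f [0..<length \<tau>] = \<tau>"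
proof (rule ccontr)
  assume not_thesis: "\<not> thesis"
  have avoid: "\<exists>\<tau>\<in>S. prefix \<sigma> \<tau> \<and> (\<forall>f\<in>Y j. map f [0..<length \<tau>] \<noteq> \<tau>)" if "\<sigma> \<in> S" for j \<sigma>
    using dense[OF that] not_thesis by blast
  have "\<exists>\<sigma>. \<forall>n. \<sigma> n \<in> S \<and> (strict_prefix (\<sigma> n) (\<sigma> (Suc n)) \<and>
      (\<forall>f\<in>Y n. map f [0..<length (\<sigma> (Suc n))] \<noteq> \<sigma> (Suc n)))"
  proof (rule dependent_nat_choice)
    fix \<sigma> n assume "\<sigma> \<in> S"
    from avoid[OF this] obtain \<tau> where \<tau>: "\<tau> \<in> S" "prefix \<sigma> \<tau>" "\<forall>f\<in>Y n. map f [0..<length \<tau>] \<noteq> \<tau>"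
      by blast
    \<comment> \<open>The extra entry makes the extension strict even when
      \<open>\<tau> = \<sigma>\<close>; members of \<open>Y n\<close> still avoid the longer
      string.\<close>
    obtain k where "\<tau> @ [k] \<in> S" using ex_succ_S[OF \<tau>(1)] .
    moreover have "strict_prefix \<sigma> (\<tau> @ [k])" using \<tau>(2) by (auto simp: strict_prefix_def)
    ultimately show "\<exists>\<rho>. \<rho> \<in> S \<and> (strict_prefix \<sigma> \<rho> \<and> (\<forall>f\<in>Y n. map f [0..<length \<rho>] \<noteq> \<rho>))"
      using \<tau>(3) by (intro exI[of _ "\<tau> @ [k]"]) auto
  qed (use Nil_mem_S in auto)
  then obtain \<sigma> where \<sigma>: "\<And>n. \<sigma> n \<in> S" "\<And>n. strict_prefix (\<sigma> n) (\<sigma> (Suc n))"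
    "\<And>n f. f \<in> Y n \<Longrightarrow> map f [0..<length (\<sigma> (Suc n))] \<noteq> \<sigma> (Suc n)" by blast
  obtain f where f: "f \<in> paths S" "\<And>n. map f [0..<length (\<sigma> n)] = \<sigma> n"
    using path_of_strict_prefix_chain[of S \<sigma>, OF tree_S \<sigma>(1,2)] by metis
  then obtain j where "f \<in> Y j" using assms by blast
  then show False using \<sigma>(3) f(2) by blast
qed

text \<open>Place one centre above each string of \<open>E\<close>. As \<open>\<alpha>\<close> is
  below \<open>1 / t m\<close> for every \<open>m < n\<close>, points of a ball of radius
  \<open>\<alpha>\<close> share their first \<open>n\<close> values with its centre, so balls over
  distinct strings are disjoint.\<close>

lemma packing_sup_ge:
  assumes \<alpha>: "0 < \<alpha>" "\<alpha> \<le> \<delta>" "\<And>m. m < n \<Longrightarrow> \<alpha> < 1 / real (t m)"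
    and E: "finite E" "E \<subseteq> level T n" "\<And>\<tau>. \<tau> \<in> E \<Longrightarrow> \<exists>f\<in>Y. map f [0..<length \<tau>] = \<tau>"
  shows "ennreal (real (card E) * (2 * \<alpha>) powr a) \<le> packing_sup a \<delta> Y"
proof -
  obtain h where h: "bij_betw h {..<card E} E"
    using ex_bij_betw_nat_finite[OF E(1)] by (auto simp: atLeast0LessThan)
  have hE: "h i \<in> E" if "i < card E" for i using h that by (auto simp: bij_betw_def)
  obtain p where p: "\<And>\<tau>. \<tau> \<in> E \<Longrightarrow> p \<tau> \<in> Y" "\<And>\<tau>. \<tau> \<in> E \<Longrightarrow> map (p \<tau>) [0..<length \<tau>] = \<tau>"
    using E(3) by metis
  have agree: "map g [0..<n] = h i" if "i < card E" "g \<in> mcball (p (h i)) \<alpha>" for g i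
  proof -
    have "p (h i) k = g k" if "k < n" for k
    proof (rule ccontr)
      assume "p (h i) k \<noteq> g k"
      then have "1 / real (t k) \<le> path_dist T (p (h i)) g" by (rule path_dist_upper)
      then show False using \<alpha>(3)[OF \<open>k < n\<close>] \<open>g \<in> _\<close> by auto
    qed
    moreover have "length (h i) = n" using hE[OF that(1)] E(2) by (auto simp: level_def)
    ultimately show ?thesis using p(2)[OF hE[OF that(1)]] by (metis map_upt_eq_iff)
  qed
  have "packing \<delta> Y {..<card E} (\<lambda>i. p (h i)) (\<lambda>_. \<alpha>)"
    unfolding packing_def
  proof (intro conjI ballI)
    show "disjoint_family_on (\<lambda>i. mcball (p (h i)) \<alpha>) {..<card E}"
      unfolding disjoint_family_on_def
    proof (intro ballI impI equals0I)
      fix i j g assume ij: "i \<in> {..<card E}" "j \<in> {..<card E}" "i \<noteq> j"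
        and g: "g \<in> mcball (p (h i)) \<alpha> \<inter> mcball (p (h j)) \<alpha>"
      have "h i = h j" using agree[of i g] agree[of j g] ij g by auto
      then show False using ij h by (auto simp: bij_betw_def inj_on_def)
    qed
  qed (use p(1) hE \<alpha> in auto)
  then have "(\<Sum>\<^sub>\<infinity>i\<in>{..<card E}. ennreal ((2 * \<alpha>) powr a)) \<le> packing_sup a \<delta> Y"
    unfolding packing_sup_def by (intro Sup_upper CollectI exI[of _ "{..<card E}"] exI[of _ "\<lambda>i. p (h i)"]
        exI[of _ "\<lambda>_. \<alpha>"]) simp
  then show ?thesis
    by (simp add: ennreal_mult ennreal_of_nat_eq_real_of_nat)
qed

text \<open>A null cover at an exponent \<open>a\<close> below the upper box dimension would have a
  member dense in a cylinder of some level \<open>k\<close>. At suitable small scales that member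
  admits packings of weight above 1, although its premeasure is below 1.\<close>

lemma upper_box_dim_le_packing_dim: "upper_box_dim (paths S) \<le> packing_dim (paths S)"
  unfolding packing_dim_def
proof (rule Inf_greatest, safe)
  fix a :: real assume a: "0 \<le> a" "packing_measure a (paths S) = 0"
  show "upper_box_dim (paths S) \<le> ereal a"
  proof (rule ccontr)
    assume "\<not> ?thesis"
    \<comment> \<open>The gap \<open>b - a\<close> later compensates for the factor
      \<open>s k\<close> lost by restricting to one cylinder.\<close>
    then obtain b where b: "a < b" "ereal b < upper_box_dim (paths S)"
      using ereal_dense2[of "ereal a" "upper_box_dim (paths S)"] by (auto simp: not_le)
    have "packing_measure a (paths S) < 1" using a(2) by simp
    then obtain Y where Y: "\<And>j. Y j \<subseteq> paths T" "paths S \<subseteq> (\<Union>j. Y j)"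
      "(\<Sum>j. packing_premeasure a (Y j)) < 1"
      unfolding packing_measure_def INF_less_iff by auto
    obtain j \<sigma> where \<sigma>: "\<sigma> \<in> S" "\<And>\<tau>. \<tau> \<in> S \<Longrightarrow> prefix \<sigma> \<tau> \<Longrightarrow> \<exists>f\<in>Y j. map f [0..<length \<tau>] = \<tau>"
      using ex_dense_in_cylinder[OF Y(2)] by blast
    define k where "k = length \<sigma>"
    have "packing_premeasure a (Y j) \<le> (\<Sum>j. packing_premeasure a (Y j))"
      using sum_le_suminf[of "\<lambda>j. packing_premeasure a (Y j)" "{j}"] by simp
    then have "packing_premeasure a (Y j) < 1" using Y(3) by (rule le_less_trans)
    then obtain \<delta> where \<delta>: "0 < \<delta>" "packing_sup a \<delta> (Y j) < 1"
      unfolding packing_premeasure_eq_INF INF_less_iff by auto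
    have "\<exists>\<^sub>F \<alpha> in at_right 0. ereal b < log_covering_number (paths S) \<alpha> / ereal (ln (1 / \<alpha>))"
      using b(2) unfolding upper_box_dim_def by (rule frequently_greater_of_less_Limsup)
    moreover have "\<forall>\<^sub>F \<alpha> in at_right 0. 0 < \<alpha> \<and> \<alpha> < 1 \<and> \<alpha> < \<delta> \<and> \<alpha> < 1 / real (t k) \<and>
        \<alpha> powr (b - a) < 1 / real (s k)"
      using b(1) \<delta>(1) t_pos[of k] s_pos[of k]
      by (intro eventually_conj eventually_powr_less_at_right_0 eventually_at_right_less)
        (auto intro: eventually_at_rightI[of _ 1] eventually_at_rightI[of _ \<delta>]
          eventually_at_rightI[of _ "1 / real (t k)"])
    ultimately have "\<exists>\<alpha>. (0 < \<alpha> \<and> \<alpha> < 1 \<and> \<alpha> < \<delta> \<and> \<alpha> < 1 / real (t k) \<and>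
        \<alpha> powr (b - a) < 1 / real (s k)) \<and>
        ereal b < log_covering_number (paths S) \<alpha> / ereal (ln (1 / \<alpha>))"
      by (rule frequently_ex[OF frequently_eventually_conj])
    then obtain \<alpha> where \<alpha>: "0 < \<alpha>" "\<alpha> < 1" "\<alpha> < \<delta>" "\<alpha> < 1 / real (t k)"
      "\<alpha> powr (b - a) < 1 / real (s k)"
      "ereal b < log_covering_number (paths S) \<alpha> / ereal (ln (1 / \<alpha>))"
      by metis
    \<comment> \<open>One level serves both purposes: its cylinders are fine enough to cover at
      scale \<open>\<alpha>\<close>, and by leastness balls of radius \<open>\<alpha>\<close>
      separate its strings. The choice \<open>\<alpha> < 1 / t k\<close> gives
      \<open>k \<le> n\<close>.\<close>
    define n where "n = (LEAST n. 1 / real (t n) \<le> \<alpha>)"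
    obtain n\<^sub>0 where "1 / real (t n\<^sub>0) \<le> \<alpha>" using ex_inverse_t_less[OF \<alpha>(1)] less_imp_le by blast
    then have n: "1 / real (t n) \<le> \<alpha>" unfolding n_def by (rule LeastI)
    have less_n: "\<alpha> < 1 / real (t m)" if "m < n" for m
      using not_less_Least[of m "\<lambda>n. 1 / real (t n) \<le> \<alpha>"] that unfolding n_def by linarith
    have "k \<le> n" using n \<alpha>(4) inverse_t_le_iff[of n k] by linarith
    have \<sigma>k: "\<sigma> \<in> level S k" using \<sigma>(1) by (simp add: level_def k_def)
    define E where "E = extensions S \<sigma> n"
    have "(1 / \<alpha>) powr b \<le> real (s n)" by (rule powr_le_s[OF \<alpha>(1,2) n \<alpha>(6)])
    also have "\<dots> = real (card E) * real (s k)"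
      unfolding E_def using card_extensions_mult_s[OF \<sigma>k \<open>k \<le> n\<close>] by (metis of_nat_mult)
    finally have card: "(1 / \<alpha>) powr b \<le> real (card E) * real (s k)" .
    \<comment> \<open>Combining \<open>\<alpha> powr (b - a) < 1 / s k\<close> with the bound on
      \<open>card E * s k\<close> lets \<open>s k\<close> cancel, leaving packing weight above
      1.\<close>
    have "real (s k) < \<alpha> powr (a - b)"
      using \<alpha>(1,5) s_pos[of k] by (simp add: powr_diff field_simps)
    also have "\<dots> = (1 / \<alpha>) powr b * \<alpha> powr a"
      using \<alpha>(1) by (simp add: powr_diff powr_divide)
    also have "\<dots> \<le> (real (card E) * real (s k)) * (2 * \<alpha>) powr a"
      using card \<alpha>(1) a(1) by (intro mult_mono powr_mono2) auto
    finally have "1 * real (s k) < (real (card E) * (2 * \<alpha>) powr a) * real (s k)" by (simp add: mult_ac)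
    then have "1 < real (card E) * (2 * \<alpha>) powr a" using s_pos[of k] by (simp only: mult_less_cancel_right_pos of_nat_0_less_iff)
    then have "1 \<le> ennreal (real (card E) * (2 * \<alpha>) powr a)"
      using ennreal_leI[of 1] by simp
    also have "\<dots> \<le> packing_sup a \<delta> (Y j)"
    proof (rule packing_sup_ge[OF \<alpha>(1) less_imp_le[OF \<alpha>(3)] less_n])
      show "finite E"
        unfolding E_def extensions_def using finite_level[OF tree_S finitely_branching_S] by simp
      show "E \<subseteq> level T n"
        using S_subset_T by (auto simp: E_def extensions_def level_def)
      fix \<tau> assume "\<tau> \<in> E"
      then have "\<tau> \<in> S" "prefix \<sigma> \<tau>" by (auto simp: E_def extensions_def level_def)
      then show "\<exists>f\<in>Y j. map f [0..<length \<tau>] = \<tau>" by (rule \<sigma>(2))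
    qed
    finally show False using \<delta>(2) by simp
  qed
qed

end

theorem theorem8p10:
  fixes S T :: "nat list set"
  assumes "tree S" and "tree T" and "S \<subseteq> T"
    and "no_leaves S"
    and "finitely_branching T"
    and "\<forall>\<sigma>\<in>T. 2 \<le> card (succs T \<sigma>)"
    and "uniformly_branching S"
  shows "Metric_space.hausdorff_dim (paths T) (path_dist T) (paths S)
           = Metric_space.lower_box_dim (paths T) (path_dist T) (paths S)
       \<and> Metric_space.packing_dim (paths T) (path_dist T) (paths S)
           = Metric_space.upper_box_dim (paths T) (path_dist T) (paths S)"
proof -
  interpret uniform_subtree S T
    using assms by unfold_locales auto
  show ?thesis
    using hausdorff_dim_le_lower_box_dim[OF paths_S_nonempty] lower_box_dim_le_hausdorff_dim
      packing_dim_le_upper_box_dim[OF paths_S_nonempty paths_S_subset] upper_box_dim_le_packing_dim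
    by (intro conjI antisym)
qed

end
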